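(* Let $G=K_n$ be the complete graph ($n\ge 2$) on vertices $v_1,\ldots,v_n$ with $\mathbf{v}_{\mathrm{out}}=v_1$ and $\mathbf{v}_{\mathrm{in}}=v_2$. For $\mathbf{r}\in\mathbb{R}^{V(G)}$, the equation $\tau_\rho=\mathbf{r}$ is solvable if and only if $\mathbf{r}\in\Psi_G$.
   Context: For a weight function $\rho:V(G)\to(0,\infty)$, the $\rho$-walk is the random walk $(w_0,w_1,\ldots)$ with $w_0=\mathbf{v}_{\mathrm{in}}$ which from $x$ moves to a neighbor $y$ with probability $\rho(y)/\sum_{z\in N(x)}\rho(z)$ ($N(x)$ the set of neighbors of $x$), stopped at the first time $T$ with $w_T=\mathbf{v}_{\mathrm{out}}$; $\tau_\rho(x)$ is the expected number of indices $0\le j\le T$ with $w_j=x$. "$\tau_\rho=\mathbf{r}$ is solvable" means there exists $\rho$ with all values strictly positive such that $\tau_\rho=\mathbf{r}$. A proper walk is a walk $\omega=(w_0=\mathbf{v}_{\mathrm{in}},\ldots,w_T=\mathbf{v}_{\mathrm{out}})$ in $G$ (consecutive vertices adjacent) with $w_j\neq\mathbf{v}_{\mathrm{out}}$ for $j<T$; its trace is $\mathrm{tr}_\omega(x)=|\{j:0\le j\le T,\ w_j=x\}|$. $\Psi_G$ is the relative interior (interior relative to the affine hull) of the convex hull of the traces of all proper walks. *)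

theory Defs
  imports "HOL-Probability.Probability" "HOL-Library.Extended_Nat"
begin

text \<open>
  A simple graph whose vertex set is the finite type \<open>'v\<close> is given by its adjacency relation
  \<open>E\<close>; vectors in \<open>\<real>\<^bsup>V(G)\<^esup>\<close> are elements of \<open>real ^ 'v\<close>.
\<close>

definition complete_adj :: "'v \<Rightarrow> 'v \<Rightarrow> bool" where
  "complete_adj x y \<longleftrightarrow> x \<noteq> y"

definition nbrs :: "('v \<Rightarrow> 'v \<Rightarrow> bool) \<Rightarrow> 'v \<Rightarrow> 'v set" where
  "nbrs E x = {y. E x y}"

text \<open>Meaningful only if \<open>x\<close> has a neighbour and \<open>\<rho>\<close> is positive; see \<open>pmf_step_pmf\<close>.\<close>

definition step_pmf :: "('v::finite \<Rightarrow> 'v \<Rightarrow> bool) \<Rightarrow> ('v \<Rightarrow> real) \<Rightarrow> 'v \<Rightarrow> 'v pmf" where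
  "step_pmf E \<rho> x =
     embed_pmf (\<lambda>y. if y \<in> nbrs E x then \<rho> y / (\<Sum>z\<in>nbrs E x. \<rho> z) else 0)"

text \<open>Law of \<open>w\<^sub>i\<close> given \<open>w\<^sub>0, \<dots>, w\<^sub>i\<^sub>-\<^sub>1\<close>.\<close>

definition walk_kernel ::
  "('v::finite \<Rightarrow> 'v \<Rightarrow> bool) \<Rightarrow> 'v \<Rightarrow> ('v \<Rightarrow> real) \<Rightarrow> nat \<Rightarrow> (nat \<Rightarrow> 'v) \<Rightarrow> 'v measure" where
  "walk_kernel E vin \<rho> i w =
     measure_pmf (case i of 0 \<Rightarrow> return_pmf vin | Suc j \<Rightarrow> step_pmf E \<rho> (w j))"

text \<open>
  The law of the (not yet stopped) walk on the trajectory space \<open>nat \<Rightarrow> 'v\<close>, obtained from the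
  Ionescu-Tulcea theorem; its finite-dimensional distributions are computed in \<open>emeasure_walk_measure\<close>.
\<close>

definition walk_measure ::
  "('v::finite \<Rightarrow> 'v \<Rightarrow> bool) \<Rightarrow> 'v \<Rightarrow> ('v \<Rightarrow> real) \<Rightarrow> (nat \<Rightarrow> 'v) measure" where
  "walk_measure E vin \<rho> =
     projective_family.lim UNIV
       (Ionescu_Tulcea.CI (walk_kernel E vin \<rho>) (\<lambda>_. count_space UNIV))
       (\<lambda>_. count_space UNIV)"

text \<open>\<open>\<infinity>\<close> if \<open>vout\<close> is never reached.\<close>

definition hit_time :: "'v \<Rightarrow> (nat \<Rightarrow> 'v) \<Rightarrow> enat" where
  "hit_time vout w = (INF j\<in>{j. w j = vout}. enat j)"

definition visits :: "'v \<Rightarrow> 'v \<Rightarrow> (nat \<Rightarrow> 'v) \<Rightarrow> ennreal" where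
  "visits vout x w = emeasure (count_space UNIV) {j. enat j \<le> hit_time vout w \<and> w j = x}"

definition expected_visits ::
  "('v::finite \<Rightarrow> 'v \<Rightarrow> bool) \<Rightarrow> 'v \<Rightarrow> 'v \<Rightarrow> ('v \<Rightarrow> real) \<Rightarrow> 'v \<Rightarrow> ennreal" where
  "expected_visits E vin vout \<rho> x = (\<integral>\<^sup>+ w. visits vout x w \<partial>walk_measure E vin \<rho>)"

text \<open>
  The comparison is made in \<open>ereal\<close> because \<open>ennreal\<close> would identify
  negative entries of \<open>r\<close> with 0.
\<close>

definition tau_solvable ::
  "('v::finite \<Rightarrow> 'v \<Rightarrow> bool) \<Rightarrow> 'v \<Rightarrow> 'v \<Rightarrow> real ^ 'v \<Rightarrow> bool" where
  "tau_solvable E vin vout r \<longleftrightarrow>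
     (\<exists>\<rho>. (\<forall>x. 0 < \<rho> x) \<and> (\<forall>x. enn2ereal (expected_visits E vin vout \<rho> x) = ereal (r $ x)))"

definition proper_walk :: "('v \<Rightarrow> 'v \<Rightarrow> bool) \<Rightarrow> 'v \<Rightarrow> 'v \<Rightarrow> 'v list \<Rightarrow> bool" where
  "proper_walk E vin vout \<omega> \<longleftrightarrow>
     \<omega> \<noteq> [] \<and> hd \<omega> = vin \<and> last \<omega> = vout \<and> successively E \<omega> \<and> vout \<notin> set (butlast \<omega>)"

definition walk_trace :: "'v list \<Rightarrow> real ^ 'v::finite" where
  "walk_trace \<omega> = (\<chi> x. real (card {j. j < length \<omega> \<and> \<omega> ! j = x}))"

definition Psi :: "('v::finite \<Rightarrow> 'v \<Rightarrow> bool) \<Rightarrow> 'v \<Rightarrow> 'v \<Rightarrow> (real ^ 'v) set" where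
  "Psi E vin vout = rel_interior (convex hull {walk_trace \<omega> | \<omega>. proper_walk E vin vout \<omega>})"

lemma pmf_step_pmf:
  assumes "\<And>y. 0 < \<rho> y" and "nbrs E x \<noteq> {}"
  shows "pmf (step_pmf E \<rho> x) y = (if y \<in> nbrs E x then \<rho> y / (\<Sum>z\<in>nbrs E x. \<rho> z) else 0)"
proof -
  let ?f = "\<lambda>y. if y \<in> nbrs E x then \<rho> y / (\<Sum>z\<in>nbrs E x. \<rho> z) else 0"
  have s: "0 < (\<Sum>z\<in>nbrs E x. \<rho> z)"
    using assms by (intro sum_pos) auto
  have nn: "0 \<le> ?f y" for y
    using s assms(1)[of y] by auto
  have "(\<integral>\<^sup>+ y. ennreal (?f y) \<partial>count_space UNIV) = (\<Sum>y\<in>UNIV. ennreal (?f y))"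
    by (rule nn_integral_count_space_finite) simp
  also have "\<dots> = ennreal (\<Sum>y\<in>UNIV. ?f y)"
    using nn by (intro sum_ennreal) auto
  also have "(\<Sum>y\<in>UNIV. ?f y) = (\<Sum>y\<in>nbrs E x. \<rho> y / (\<Sum>z\<in>nbrs E x. \<rho> z))"
    by (simp add: sum.If_cases)
  also have "\<dots> = 1"
    using s by (simp add: sum_divide_distrib[symmetric])
  finally show ?thesis
    unfolding step_pmf_def by (subst pmf_embed_pmf) (use nn in auto)
qed

lemma Ionescu_Tulcea_walk_kernel:
  "Ionescu_Tulcea (walk_kernel E vin \<rho>) (\<lambda>_. count_space UNIV)"
proof (rule Ionescu_Tulcea.intro)
  fix i
  show "walk_kernel E vin \<rho> i \<in> measurable (PiM {0..<i} (\<lambda>_. count_space UNIV))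
          (subprob_algebra (count_space UNIV))"
  proof (cases i)
    case 0
    then show ?thesis
      by (simp add: walk_kernel_def[abs_def] measure_pmf_in_subprob_algebra)
  next
    case (Suc j)
    have "(\<lambda>w. w j) \<in> measurable (PiM {0..<i} (\<lambda>_. count_space UNIV)) (count_space UNIV)"
      using Suc by (intro measurable_component_singleton) auto
    then have "(\<lambda>w. measure_pmf (step_pmf E \<rho> (w j))) \<in> measurable (PiM {0..<i} (\<lambda>_. count_space UNIV))
          (subprob_algebra (count_space UNIV))"
      by (rule measurable_compose) (simp add: measure_pmf_in_subprob_algebra)
    then show ?thesis
      by (simp add: walk_kernel_def[abs_def] Suc)
  qed
next
  show "prob_space (walk_kernel E vin \<rho> i x)" for i x
    by (simp add: walk_kernel_def measure_pmf.prob_space_axioms)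
qed

lemma emeasure_walk_measure:
  "emeasure (walk_measure E vin \<rho>) {w. \<forall>i\<le>k. w i = x i} =
     ennreal ((if x 0 = vin then 1 else 0) * (\<Prod>i<k. pmf (step_pmf E \<rho> (x i)) (x (Suc i))))"
proof -
  let ?M = "\<lambda>_::nat. count_space (UNIV :: 'a set)"
  let ?K = "walk_kernel E vin \<rho>"
  interpret IT: Ionescu_Tulcea ?K ?M
    by (rule Ionescu_Tulcea_walk_kernel)
  define X where "X n = PiE {0..<n} (\<lambda>i. {x i})" for n
  have X[measurable]: "X n \<in> sets (PiM {0..<n} ?M)" for n
    unfolding X_def by (intro sets_PiM_I_finite) auto
  have X_eq: "X n = {restrict x {0..<n}}" for n
    by (auto simp: X_def PiE_iff extensional_def fun_eq_iff)
  let ?C = "\<lambda>n. IT.C 0 n (\<lambda>_. undefined)"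
  have u: "(\<lambda>_. undefined) \<in> space (PiM {0..<0} ?M)"
    by simp
  have step: "emeasure (?C (Suc n)) (X (Suc n)) =
      emeasure (?K n (restrict x {0..<n})) {x n} * emeasure (?C n) (X n)" for n
  proof -
    have sp: "space (?C n) = space (PiM {0..<n} ?M)"
      using IT.space_C[OF u, of n] by simp
    have st: "sets (?C n) = sets (PiM {0..<n} ?M)"
      using IT.sets_C[OF u, of n] by simp
    have m: "IT.eP n \<in> measurable (?C n) (subprob_algebra (PiM {0..<Suc n} ?M))"
      unfolding measurable_cong_sets[OF st refl] by (rule IT.measurable_eP)
    have ne: "space (?C n) \<noteq> {}"
      by (simp add: sp space_PiM_empty_iff)
    have "emeasure (?C (Suc n)) (X (Suc n)) = (\<integral>\<^sup>+ w. emeasure (IT.eP n w) (X (Suc n)) \<partial>?C n)"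
      using emeasure_bind[OF ne m X] by simp
    also have "\<dots> = (\<integral>\<^sup>+ w. emeasure (?K n (restrict x {0..<n})) {x n} * indicator (X n) w \<partial>?C n)"
    proof (rule nn_integral_cong)
      fix w assume "w \<in> space (?C n)"
      then have w: "w \<in> space (PiM {0..<n} ?M)"
        by (simp add: sp)
      then have ext: "w \<in> extensional {0..<n}"
        by (auto simp: space_PiM PiE_iff)
      have "(\<lambda>y. w(n := y)) -` X (Suc n) = (if w \<in> X n then {x n} else {})"
        using ext by (auto simp: X_def PiE_iff extensional_def less_Suc_eq split: if_splits)
      then show "emeasure (IT.eP n w) (X (Suc n)) =
          emeasure (?K n (restrict x {0..<n})) {x n} * indicator (X n) w"
        by (subst IT.emeasure_eP[OF w X]) (auto simp: X_eq)
    qed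
    also have "\<dots> = emeasure (?K n (restrict x {0..<n})) {x n} * emeasure (?C n) (X n)"
      by (rule nn_integral_cmult_indicator) (simp add: st X)
    finally show ?thesis .
  qed
  have C: "emeasure (?C (Suc k)) (X (Suc k)) =
     ennreal ((if x 0 = vin then 1 else 0) * (\<Prod>i<k. pmf (step_pmf E \<rho> (x i)) (x (Suc i))))" for k
  proof (induction k)
    case 0
    have "emeasure (?C 0) (X 0) = 1"
      by (simp add: X_eq restrict_def PiM_empty)
    then show ?case
      by (subst step) (auto simp: walk_kernel_def emeasure_pmf_single)
  next
    case (Suc k)
    show ?case
      by (subst step, subst Suc)
        (auto simp: walk_kernel_def emeasure_pmf_single ennreal_mult'[symmetric] mult.commute)
  qed
  have "{w. \<forall>i\<le>k. w i = x i} = prod_emb UNIV ?M {0..<Suc k} (X (Suc k))"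
    by (auto simp: prod_emb_def X_def PiE_iff less_Suc_eq_le)
  then have "emeasure (walk_measure E vin \<rho>) {w. \<forall>i\<le>k. w i = x i} =
      emeasure (IT.CI {0..<Suc k}) (X (Suc k))"
    unfolding walk_measure_def by (simp only:) (rule IT.lim, auto)
  also have "\<dots> = emeasure (IT.C 0 (Suc k) (\<lambda>_. undefined)) (X (Suc k))"
    by (subst IT.emeasure_CI[of _ "Suc k"], simp, rule X, subst prod_emb_id)
      (auto simp: X_def PiE_iff)
  finally show ?thesis
    by (simp only: C)
qed

end

theory Submission
  imports Defs
begin

text \<open>
  Write \<open>s\<close>, \<open>t\<close> for the start and the target. The expected visits solve a linear
  system which on the complete graph decouples and has the explicit solution
  \<open>\<tau> y = ([y = s] + \<rho> y / \<rho> t) (1 - \<rho> y / S)\<close>, where \<open>S\<close> is the total weight.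
  With \<open>p = \<rho> / S\<close> and \<open>q = p t\<close>, the excess \<open>m y = r y - [y = s]\<close> is attained iff
  \<open>p y (1 - [y = s] q - p y) = q m y\<close> for all \<open>y \<noteq> t\<close> and \<open>p\<close> sums to 1.
  If there is a third vertex, then both solvability of this system and membership in \<open>\<Psi>\<close>
  (together with \<open>r t = 1\<close>) amount to \<open>0 < m x < (\<Sum>z \<notin> {t, x}. m z) + [x \<noteq> s]\<close> for all
  \<open>x \<noteq> t\<close>: the former by an intermediate value argument in \<open>q\<close>, the latter because the
  walks \<open>s (i j)\<^sup>k t\<close>, \<open>s y t\<close> and \<open>s t\<close> generate the polyhedron cut out by the weak
  inequalities.
\<close>

section \<open>Expected visits on the complete graph\<close>

text \<open>Mass reaching \<open>t\<close> is recorded but never propagated. For the walk kernel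
  this is the probability of being at \<open>y\<close> at time \<open>j\<close> with no visit to
  \<open>t\<close> strictly before \<open>j\<close>, so the visit at the hitting time itself is
  counted.\<close>

primrec killed_law :: "('v::finite \<Rightarrow> 'v \<Rightarrow> real) \<Rightarrow> 'v \<Rightarrow> 'v \<Rightarrow> nat \<Rightarrow> 'v \<Rightarrow> real" where
  "killed_law P s t 0 y = of_bool (y = s)"
| "killed_law P s t (Suc j) y = (\<Sum>x\<in>-{t}. killed_law P s t j x * P x y)"

lemma killed_law_nonneg:
  assumes "\<And>x y. 0 \<le> P x y"
  shows "0 \<le> killed_law P s t j y"
  using assms by (induction j arbitrary: y) (auto intro!: sum_nonneg)

text \<open>Induction on \<open>k\<close>, feeding the bound back into the equation for
  \<open>h\<close>. One nonnegative solution thus yields summability, without first proving that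
  \<open>t\<close> is hit almost surely.\<close>

lemma sum_killed_law_le:
  assumes P: "\<And>x y. 0 \<le> P x y"
    and h: "\<And>y. h y = of_bool (y = s) + (\<Sum>x\<in>-{t}. h x * P x y)" and h0: "\<And>y. 0 \<le> h y"
  shows "(\<Sum>j<k. killed_law P s t j y) \<le> h y"
proof (induction k arbitrary: y)
  case 0
  then show ?case using h0 by simp
next
  case (Suc k)
  have "(\<Sum>j<Suc k. killed_law P s t j y) =
      of_bool (y = s) + (\<Sum>j<k. \<Sum>x\<in>-{t}. killed_law P s t j x * P x y)"
    by (simp add: sum.lessThan_Suc_shift del: sum.lessThan_Suc)
  also have "(\<Sum>j<k. \<Sum>x\<in>-{t}. killed_law P s t j x * P x y) =
      (\<Sum>x\<in>-{t}. (\<Sum>j<k. killed_law P s t j x) * P x y)"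
    by (subst sum.swap) (simp add: sum_distrib_right)
  also have "of_bool (y = s) + \<dots> \<le> of_bool (y = s) + (\<Sum>x\<in>-{t}. h x * P x y)"
    by (intro add_left_mono sum_mono mult_right_mono Suc P)
  finally show ?case using h[of y] by simp
qed

lemma suminf_killed_law:
  assumes sm: "\<And>y. summable (\<lambda>j. killed_law P s t j y)"
  shows "(\<Sum>j. killed_law P s t j y) =
    of_bool (y = s) + (\<Sum>x\<in>-{t}. (\<Sum>j. killed_law P s t j x) * P x y)"
proof -
  have "(\<Sum>j. killed_law P s t j y) = (\<Sum>j. killed_law P s t (Suc j) y) + killed_law P s t 0 y"
    by (subst suminf_split_head[OF sm]) simp
  also have "(\<Sum>j. killed_law P s t (Suc j) y) = (\<Sum>x\<in>-{t}. \<Sum>j. killed_law P s t j x * P x y)"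
    by (simp, rule suminf_sum) (intro summable_mult2 sm)
  also have "\<dots> = (\<Sum>x\<in>-{t}. (\<Sum>j. killed_law P s t j x) * P x y)"
    by (simp add: suminf_mult2[OF sm])
  finally show ?thesis by simp
qed

section \<open>Hitting events under the walk measure\<close>

lemma space_walk_measure: "space (walk_measure E s \<rho>) = UNIV"
  and sets_walk_measure:
    "sets (walk_measure E s \<rho>) = sets (PiM UNIV (\<lambda>_. count_space UNIV))"
proof -
  interpret IT: Ionescu_Tulcea "walk_kernel E s \<rho>" "\<lambda>_. count_space UNIV"
    by (rule Ionescu_Tulcea_walk_kernel)
  show "space (walk_measure E s \<rho>) = UNIV"
    unfolding walk_measure_def by (simp add: space_PiM)
  show "sets (walk_measure E s \<rho>) = sets (PiM UNIV (\<lambda>_. count_space UNIV))"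
    unfolding walk_measure_def by simp
qed

lemma measurable_walk_component:
  "(\<lambda>w. w i) \<in> measurable (walk_measure E s \<rho>) (count_space (UNIV :: 'v::finite set))"
  unfolding measurable_cong_sets[OF sets_walk_measure refl]
  by (rule measurable_component_singleton) simp

lemma sets_walk_measure_cylinder:
  "{w. \<forall>i\<le>k. w i = x i} \<in> sets (walk_measure E s \<rho>)" for x :: "nat \<Rightarrow> 'v::finite"
proof -
  note [measurable] = measurable_walk_component
  have "{w \<in> space (walk_measure E s \<rho>). \<forall>i\<in>{..k}. w i = x i} \<in> sets (walk_measure E s \<rho>)"
    by measurable
  then show ?thesis by (simp add: space_walk_measure Ball_def)
qed

text \<open>Extensionality encodes a path up to time \<open>k\<close> as one function, so
  \<open>A\<close> is finite and distinct members give disjoint cylinders.\<close>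

lemma emeasure_walk_measure_finite_union:
  fixes A :: "(nat \<Rightarrow> 'v::finite) set"
  assumes "A \<subseteq> extensional {..k}"
  shows "emeasure (walk_measure E s \<rho>) {w. restrict w {..k} \<in> A} =
    (\<Sum>a\<in>A. emeasure (walk_measure E s \<rho>) {w. \<forall>i\<le>k. w i = a i})"
proof -
  have "A \<subseteq> PiE {..k} (\<lambda>_. UNIV)" using assms by (auto simp: PiE_def)
  then have fin: "finite A" by (rule finite_subset) (simp add: finite_PiE)
  have disj: "disjoint_family_on (\<lambda>a. {w. \<forall>i\<le>k. w i = a i}) A"
  proof (clarsimp simp: disjoint_family_on_def)
    fix a b assume "a \<in> A" "b \<in> A" "a \<noteq> b"
    then obtain i where "a i \<noteq> b i" by auto
    moreover have "i \<le> k"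
    proof (rule ccontr)
      assume "\<not> i \<le> k"
      then have "a i = undefined" "b i = undefined"
        using \<open>a \<in> A\<close> \<open>b \<in> A\<close> assms by (auto intro: extensional_arb)
      with \<open>a i \<noteq> b i\<close> show False by simp
    qed
    ultimately show "{w. \<forall>i\<le>k. w i = a i} \<inter> {w. \<forall>i\<le>k. w i = b i} = {}" by auto
  qed
  have "{w. restrict w {..k} \<in> A} = (\<Union>a\<in>A. {w. \<forall>i\<le>k. w i = a i})"
  proof (intro set_eqI iffI)
    fix w assume "w \<in> {w. restrict w {..k} \<in> A}"
    then show "w \<in> (\<Union>a\<in>A. {w. \<forall>i\<le>k. w i = a i})"
      by (auto intro!: bexI[of _ "restrict w {..k}"])
  next
    fix w assume "w \<in> (\<Union>a\<in>A. {w. \<forall>i\<le>k. w i = a i})"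
    then obtain a where a: "a \<in> A" "\<forall>i\<le>k. w i = a i" by auto
    then have "restrict w {..k} = a" using assms
      by (intro ext) (auto simp: extensional_def)
    then show "w \<in> {w. restrict w {..k} \<in> A}" using a by auto
  qed
  then show ?thesis
    using sum_emeasure[OF _ disj fin] by (simp add: sets_walk_measure_cylinder image_subset_iff)
qed

text \<open>Induction on \<open>j\<close>: the event at time \<open>Suc j\<close> is cut into
  cylinders, each gaining one transition factor, and these are grouped by the vertex occupied at
  time \<open>j\<close>.\<close>

lemma emeasure_walk_measure_hit:
  fixes s t y :: "'v::finite"
  shows "emeasure (walk_measure E s \<rho>) {w. (\<forall>i<j. w i \<noteq> t) \<and> w j = y} =
    ennreal (killed_law (\<lambda>x. pmf (step_pmf E \<rho> x)) s t j y)"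
proof (induction j arbitrary: y)
  case 0
  show ?case using emeasure_walk_measure[where k = 0 and x = "\<lambda>_. y"]
    by (auto simp: of_bool_def)
next
  case (Suc j)
  let ?W = "walk_measure E s \<rho>" and ?P = "\<lambda>x. pmf (step_pmf E \<rho> x)"
  \<comment> \<open>Paths in \<open>A\<close> avoid \<open>t\<close> through time \<open>j\<close>,
    those in \<open>B x\<close> only before time \<open>j\<close>; hence \<open>A\<close> is the
    union of the \<open>B x\<close> with \<open>x \<noteq> t\<close>.\<close>
  define A where "A = {a \<in> extensional {..j}. \<forall>i\<le>j. a i \<noteq> t}"
  define B where "B x = {a \<in> extensional {..j}. (\<forall>i<j. a i \<noteq> t) \<and> a j = x}" for x
  have finB: "finite (B x)" for x
    by (rule finite_subset[of _ "PiE {..j} (\<lambda>_. UNIV)"]) (force simp: B_def PiE_iff, simp add: finite_PiE)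
  define up where "up a = a(Suc j := y)" for a :: "nat \<Rightarrow> 'v"
  have inj: "inj_on up A"
  proof (rule inj_onI)
    fix a b assume ab: "a \<in> A" "b \<in> A" "up a = up b"
    show "a = b"
    proof
      fix i show "a i = b i"
        using ab(1,2) fun_cong[OF ab(3), of i]
        by (cases "i = Suc j") (auto simp: up_def A_def extensional_def)
    qed
  qed
  have AB: "A = (\<Union>x\<in>-{t}. B x)"
    by (auto simp: A_def B_def le_less)
  have upA: "up ` A \<subseteq> extensional {..Suc j}"
    by (auto simp: A_def up_def extensional_def)
  have "{w. (\<forall>i<Suc j. w i \<noteq> t) \<and> w (Suc j) = y} = {w. restrict w {..Suc j} \<in> up ` A}"
  proof (intro set_eqI iffI)
    fix w assume "w \<in> {w. (\<forall>i<Suc j. w i \<noteq> t) \<and> w (Suc j) = y}"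
    then show "w \<in> {w. restrict w {..Suc j} \<in> up ` A}"
      by (auto intro!: image_eqI[of _ _ "restrict w {..j}"] simp: up_def A_def fun_eq_iff less_Suc_eq_le)
  next
    fix w assume "w \<in> {w. restrict w {..Suc j} \<in> up ` A}"
    then obtain a where a: "a \<in> A" "restrict w {..Suc j} = up a" by auto
    have "w i = up a i" if "i \<le> Suc j" for i
      using fun_cong[OF a(2), of i] that by simp
    then show "w \<in> {w. (\<forall>i<Suc j. w i \<noteq> t) \<and> w (Suc j) = y}"
      using a(1) by (auto simp: up_def A_def)
  qed
  then have "emeasure ?W {w. (\<forall>i<Suc j. w i \<noteq> t) \<and> w (Suc j) = y} =
      (\<Sum>a\<in>A. emeasure ?W {w. \<forall>i\<le>Suc j. w i = up a i})"
    by (simp add: emeasure_walk_measure_finite_union[OF upA] sum.reindex[OF inj])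
  also have "\<dots> = (\<Sum>a\<in>A. emeasure ?W {w. \<forall>i\<le>j. w i = a i} * ennreal (?P (a j) y))"
  proof (rule sum.cong[OF refl])
    fix a
    have "(\<Prod>i<j. ?P (up a i) (up a (Suc i))) = (\<Prod>i<j. ?P (a i) (a (Suc i)))"
      by (rule prod.cong) (auto simp: up_def)
    then show "emeasure ?W {w. \<forall>i\<le>Suc j. w i = up a i} =
        emeasure ?W {w. \<forall>i\<le>j. w i = a i} * ennreal (?P (a j) y)"
      unfolding emeasure_walk_measure
      by (simp add: up_def ennreal_mult prod_nonneg)
  qed
  also have "\<dots> = (\<Sum>x\<in>-{t}. \<Sum>a\<in>B x. emeasure ?W {w. \<forall>i\<le>j. w i = a i} * ennreal (?P (a j) y))"
    unfolding AB by (rule sum.UNION_disjoint) (auto simp: finB, auto simp: B_def)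
  also have "\<dots> = (\<Sum>x\<in>-{t}. emeasure ?W {w. (\<forall>i<j. w i \<noteq> t) \<and> w j = x} * ennreal (?P x y))"
  proof (rule sum.cong[OF refl])
    fix x
    have *: "{w. restrict w {..j} \<in> B x} = {w. (\<forall>i<j. w i \<noteq> t) \<and> w j = x}"
      by (auto simp: B_def)
    have "(\<Sum>a\<in>B x. emeasure ?W {w. \<forall>i\<le>j. w i = a i} * ennreal (?P (a j) y)) =
        (\<Sum>a\<in>B x. emeasure ?W {w. \<forall>i\<le>j. w i = a i}) * ennreal (?P x y)"
      unfolding sum_distrib_right by (rule sum.cong) (auto simp: B_def)
    also have "(\<Sum>a\<in>B x. emeasure ?W {w. \<forall>i\<le>j. w i = a i}) =
        emeasure ?W {w. (\<forall>i<j. w i \<noteq> t) \<and> w j = x}"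
      unfolding *[symmetric] by (rule emeasure_walk_measure_finite_union[symmetric]) (auto simp: B_def)
    finally show "(\<Sum>a\<in>B x. emeasure ?W {w. \<forall>i\<le>j. w i = a i} * ennreal (?P (a j) y)) =
        emeasure ?W {w. (\<forall>i<j. w i \<noteq> t) \<and> w j = x} * ennreal (?P x y)" .
  qed
  also have "\<dots> = (\<Sum>x\<in>-{t}. ennreal (killed_law ?P s t j x * ?P x y))"
    by (simp add: Suc ennreal_mult killed_law_nonneg)
  also have "\<dots> = ennreal (killed_law ?P s t (Suc j) y)"
    by (simp add: sum_ennreal killed_law_nonneg)
  finally show ?case .
qed

text \<open>An index \<open>j\<close> is at most the hitting time iff \<open>t\<close> is absent
  before \<open>j\<close>, also when \<open>t\<close> is never reached. The visits are therefore a
  sum of indicators, and monotone convergence exchanges sum and integral.\<close>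

lemma expected_visits_eq_suminf:
  "expected_visits E s t \<rho> x =
    (\<Sum>j. ennreal (killed_law (\<lambda>x. pmf (step_pmf E \<rho> x)) s t j x))"
proof -
  note [measurable] = measurable_walk_component
  let ?W = "walk_measure E s \<rho>"
  define B where "B j = {w. (\<forall>i<j. w i \<noteq> t) \<and> w j = x}" for j :: nat
  have B: "B j \<in> sets ?W" for j
  proof -
    have "{w \<in> space ?W. (\<forall>i\<in>{..<j}. w i \<noteq> t) \<and> w j = x} \<in> sets ?W"
      by measurable
    then show ?thesis by (simp add: space_walk_measure B_def Ball_def)
  qed
  have visits: "visits t x w = (\<Sum>j. indicator (B j) w)" for w
  proof -
    have "{j. enat j \<le> hit_time t w \<and> w j = x} = {j. w \<in> B j}"
      unfolding hit_time_def B_def le_INF_iff by (auto simp: not_le[symmetric])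
    then have "visits t x w = (\<integral>\<^sup>+ j. indicator {j. w \<in> B j} j \<partial>count_space UNIV)"
      by (simp add: visits_def)
    also have "\<dots> = (\<Sum>j. indicator (B j) w)"
      by (simp add: nn_integral_count_space_nat indicator_def)
    finally show ?thesis .
  qed
  have "expected_visits E s t \<rho> x = (\<Sum>j. \<integral>\<^sup>+ w. indicator (B j) w \<partial>?W)"
    unfolding expected_visits_def visits by (rule nn_integral_suminf) (rule borel_measurable_indicator[OF B])
  also have "\<dots> = (\<Sum>j. emeasure ?W (B j))"
    by (simp add: B)
  finally show ?thesis
    by (simp add: B_def emeasure_walk_measure_hit)
qed

section \<open>Explicit solution on the complete graph\<close>

text \<open>With \<open>S\<close> the total weight, the second branch would give
  \<open>1 - \<rho> t / S\<close> at the target instead of the correct value 1.\<close>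

definition occupation :: "'v \<Rightarrow> 'v \<Rightarrow> ('v::finite \<Rightarrow> real) \<Rightarrow> 'v \<Rightarrow> real" where
  "occupation s t \<rho> y = (if y = t then 1
     else (of_bool (y = s) + \<rho> y / \<rho> t) * (1 - \<rho> y / (\<Sum>z\<in>UNIV. \<rho> z)))"

lemma pmf_step_pmf_complete:
  fixes \<rho> :: "'v::finite \<Rightarrow> real"
  assumes \<rho>: "\<And>x. 0 < \<rho> x" and st: "s \<noteq> (t::'v)"
  shows "pmf (step_pmf complete_adj \<rho> x) y = (if y = x then 0 else \<rho> y / ((\<Sum>z\<in>UNIV. \<rho> z) - \<rho> x))"
    and "\<rho> x < (\<Sum>z\<in>UNIV. \<rho> z)"
proof -
  have nb: "nbrs complete_adj x = -{x}" by (auto simp: nbrs_def complete_adj_def)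
  have ne: "-{x} \<noteq> {}" using st by (cases "x = s") auto
  have S: "(\<Sum>z\<in>UNIV. \<rho> z) = \<rho> x + (\<Sum>z\<in>-{x}. \<rho> z)"
    by (subst sum.remove[of _ x]) (auto simp: Compl_eq_Diff_UNIV)
  show "pmf (step_pmf complete_adj \<rho> x) y = (if y = x then 0 else \<rho> y / ((\<Sum>z\<in>UNIV. \<rho> z) - \<rho> x))"
    using ne by (subst pmf_step_pmf) (auto simp: nb \<rho> S)
  have "0 < (\<Sum>z\<in>-{x}. \<rho> z)" using ne \<rho> by (intro sum_pos) auto
  then show "\<rho> x < (\<Sum>z\<in>UNIV. \<rho> z)" using S by simp
qed

text \<open>Dividing a solution by \<open>S - \<rho> x\<close> decouples the system: only the sum
  over all \<open>x \<noteq> t\<close> of the quotients remains as an unknown.\<close>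

lemma occupation_iff:
  fixes \<rho> :: "'v::finite \<Rightarrow> real"
  assumes \<rho>: "\<And>x. 0 < \<rho> x" and st: "s \<noteq> (t::'v)"
  defines "P \<equiv> \<lambda>x. pmf (step_pmf complete_adj \<rho> x)"
  shows "(\<forall>y. h y = of_bool (y = s) + (\<Sum>x\<in>-{t}. h x * P x y)) \<longleftrightarrow> h = occupation s t \<rho>"
proof -
  define S where "S = (\<Sum>z\<in>UNIV. \<rho> z)"
  define b where "b x = h x / (S - \<rho> x)" for x
  define A where "A = (\<Sum>x\<in>-{t}. b x)"
  have lt: "\<rho> x < S" for x
    unfolding S_def by (rule pmf_step_pmf_complete(2)[where \<rho> = \<rho>, OF \<rho> st])
  have S0: "0 < S" using lt[of s] \<rho>[of s] by simp
  have hb: "h x = b x * (S - \<rho> x)" for x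
    using lt[of x] by (simp add: b_def)
  have S_split: "S = \<rho> t + (\<Sum>z\<in>-{t}. \<rho> z)"
    unfolding S_def by (subst sum.remove[of _ t]) (auto simp: Compl_eq_Diff_UNIV)
  \<comment> \<open>There are no loops, so the term \<open>x = y\<close> has to be removed from the
    full sum; it is present only for \<open>y \<noteq> t\<close>.\<close>
  have sum_eq: "(\<Sum>x\<in>-{t}. h x * P x y) = \<rho> y * (A - of_bool (y \<noteq> t) * b y)" for y
  proof -
    have "(\<Sum>x\<in>-{t}. h x * P x y) = (\<Sum>x\<in>-{t}. \<rho> y * (b x - of_bool (x = y) * b x))"
      by (rule sum.cong)
        (auto simp: P_def pmf_step_pmf_complete(1)[where \<rho> = \<rho>, OF \<rho> st] S_def[symmetric] b_def)
    also have "\<dots> = \<rho> y * (A - (\<Sum>x\<in>-{t}. of_bool (x = y) * b x))"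
      by (simp add: sum_distrib_left[symmetric] sum_subtractf A_def)
    also have "(\<Sum>x\<in>-{t}. of_bool (x = y) * b x) = of_bool (y \<noteq> t) * b y"
      by (simp add: of_bool_def if_distrib[where f = "\<lambda>z. z * _"] sum.delta' cong: if_cong)
    finally show ?thesis .
  qed
  have occ: "occupation s t \<rho> y = (of_bool (y = s) + \<rho> y / \<rho> t) / S * (S - \<rho> y)" if "y \<noteq> t" for y
    using that S0 by (simp add: occupation_def S_def[symmetric] field_simps)
  show ?thesis
  proof
    assume eq: "\<forall>y. h y = of_bool (y = s) + (\<Sum>x\<in>-{t}. h x * P x y)"
    have bS: "b y * S = of_bool (y = s) + \<rho> y * A" if "y \<noteq> t" for y
      using eq[rule_format, of y] that unfolding sum_eq by (simp add: hb algebra_simps)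
    \<comment> \<open>Summing the decoupled equations over \<open>y \<noteq> t\<close> leaves one
      linear equation for \<open>A\<close>.\<close>
    have "A * S = (\<Sum>y\<in>-{t}. of_bool (y = s) + \<rho> y * A)"
      unfolding A_def sum_distrib_right by (rule sum.cong) (auto simp: bS A_def[symmetric])
    also have "\<dots> = 1 + (S - \<rho> t) * A"
      using st by (simp add: sum.distrib S_split sum_distrib_right of_bool_def sum.delta' cong: if_cong)
    finally have A: "A = 1 / \<rho> t"
      using \<rho>[of t] by (simp add: field_simps)
    show "h = occupation s t \<rho>"
    proof
      fix y show "h y = occupation s t \<rho> y"
      proof (cases "y = t")
        case True
        then show ?thesis
          using eq[rule_format, of t] st A \<rho>[of t] by (simp add: sum_eq occupation_def)
      next
        case False
        then have "b y = (of_bool (y = s) + \<rho> y / \<rho> t) / S"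
          using bS[OF False] A S0 by (simp add: field_simps)
        then show ?thesis using occ[OF False] hb[of y] by simp
      qed
    qed
  next
    assume h: "h = occupation s t \<rho>"
    have b: "b y = (of_bool (y = s) + \<rho> y / \<rho> t) / S" if "y \<noteq> t" for y
      using occ[OF that] lt[of y] by (simp add: b_def h)
    have "A = (\<Sum>y\<in>-{t}. (of_bool (y = s) + \<rho> y / \<rho> t) / S)"
      unfolding A_def by (rule sum.cong) (auto simp: b)
    also have "\<dots> = (1 + (S - \<rho> t) / \<rho> t) / S"
      using st by (simp add: sum.distrib S_split sum_divide_distrib[symmetric] of_bool_def sum.delta' cong: if_cong)
    also have "\<dots> = 1 / \<rho> t"
      using \<rho>[of t] S0 by (simp add: field_simps)
    finally have A: "A = 1 / \<rho> t" .
    show "\<forall>y. h y = of_bool (y = s) + (\<Sum>x\<in>-{t}. h x * P x y)"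
    proof
      fix y show "h y = of_bool (y = s) + (\<Sum>x\<in>-{t}. h x * P x y)"
      proof (cases "y = t")
        case True
        then show ?thesis using st A \<rho>[of t] unfolding sum_eq by (simp add: h occupation_def)
      next
        case False
        have "b y * S = of_bool (y = s) + \<rho> y * A"
          using b[OF False] A S0 by simp
        then show ?thesis using False by (simp add: sum_eq hb[of y] algebra_simps)
      qed
    qed
  qed
qed

text \<open>The explicit solution is nonnegative and so bounds the partial sums of
  \<open>killed_law\<close>. The series then converges, its limit solves the same system, and
  uniqueness identifies the two.\<close>

lemma expected_visits_complete:
  fixes \<rho> :: "'v::finite \<Rightarrow> real"
  assumes \<rho>: "\<And>x. 0 < \<rho> x" and st: "s \<noteq> t"
  shows "expected_visits complete_adj s t \<rho> x = ennreal (occupation s t \<rho> x)"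
    and "0 \<le> occupation s t \<rho> x"
proof -
  let ?k = "killed_law (\<lambda>x. pmf (step_pmf complete_adj \<rho> x)) s t"
  have occ0: "0 \<le> occupation s t \<rho> y" for y
    using pmf_step_pmf_complete(2)[where \<rho> = \<rho> and x = y, OF \<rho> st] \<rho>[of y] \<rho>[of t]
    by (auto simp: occupation_def divide_simps intro!: mult_nonneg_nonneg)
  then show "0 \<le> occupation s t \<rho> x" .
  have k0: "0 \<le> ?k j y" for j y by (simp add: killed_law_nonneg)
  have sm: "summable (\<lambda>j. ?k j y)" for y
  proof (rule summableI_nonneg_bounded[OF k0])
    show "(\<Sum>j<n. ?k j y) \<le> occupation s t \<rho> y" for n
      by (rule sum_killed_law_le[OF pmf_nonneg
            occupation_iff[where \<rho> = \<rho>, THEN iffD2, OF \<rho> st refl, rule_format] occ0])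
  qed
  have "(\<lambda>y. \<Sum>j. ?k j y) = occupation s t \<rho>"
    by (rule occupation_iff[where \<rho> = \<rho>, THEN iffD1, OF \<rho> st]) (intro allI suminf_killed_law sm)
  then have "(\<Sum>j. ?k j x) = occupation s t \<rho> x" by (rule fun_cong)
  then show "expected_visits complete_adj s t \<rho> x = ennreal (occupation s t \<rho> x)"
    unfolding expected_visits_eq_suminf
    by (subst suminf_ennreal2[OF k0 sm]) simp
qed

text \<open>As \<open>occupation\<close> is nonnegative, \<open>ennreal\<close> does not truncate
  it, and the comparison in \<open>ereal\<close> becomes one of reals.\<close>

lemma tau_solvable_complete_iff:
  fixes r :: "real ^ 'v::finite"
  assumes "s \<noteq> t"
  shows "tau_solvable complete_adj s t r \<longleftrightarrow>
    (\<exists>\<rho>. (\<forall>x. 0 < \<rho> x) \<and> (\<forall>x. r $ x = occupation s t \<rho> x))"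
proof -
  have "enn2ereal (expected_visits complete_adj s t \<rho> x) = ereal (r $ x) \<longleftrightarrow>
      r $ x = occupation s t \<rho> x" if "\<forall>x. 0 < \<rho> x" for \<rho> x
    using expected_visits_complete[of \<rho> s t x] that assms
    by (auto simp: enn2ereal_ennreal)
  then show ?thesis unfolding tau_solvable_def by metis
qed

section \<open>Convex hull of the traces\<close>

text \<open>Discarding the visit at time 0 gives the walk \<open>[s, t]\<close> excess 0 at every
  vertex except \<open>t\<close>.\<close>

definition excess :: "'v \<Rightarrow> real ^ 'v \<Rightarrow> 'v::finite \<Rightarrow> real" where
  "excess s r x = r $ x - of_bool (x = s)"

definition trace_region :: "'v \<Rightarrow> 'v \<Rightarrow> (real ^ 'v::finite) set" where
  "trace_region s t = {r. r $ t = 1 \<and> (\<forall>x\<in>-{t}. 0 < excess s r x \<and>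
     excess s r x < (\<Sum>z\<in>-{t}-{x}. excess s r z) + of_bool (x \<noteq> s))}"

lemma walk_trace_nth: "walk_trace \<omega> $ x = real (count_list \<omega> x)"
  by (simp add: walk_trace_def count_list_eq_length_filter length_filter_conv_card eq_commute)

text \<open>Occurrences of \<open>x\<close> are at least two positions apart; the extra 1 is needed
  only when the list starts with \<open>x\<close>.\<close>

lemma count_list_successively_neq:
  assumes "successively (\<noteq>) xs" "xs \<noteq> []"
  shows "2 * count_list xs x \<le> length xs + of_bool (hd xs = x)"
  using assms by (induction xs rule: induct_list012) (auto split: if_splits)

text \<open>Without its final \<open>t\<close>, the walk has length equal to the sum of its visit
  counts, so the spacing bound says that visits to \<open>x\<close> exceed those to the other
  vertices by at most \<open>[x = s]\<close>. Passing to excesses turns this into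
  \<open>[x \<noteq> s]\<close>.\<close>

lemma excess_walk_trace:
  fixes s t :: "'v::finite"
  assumes w: "proper_walk complete_adj s t \<omega>" and st: "s \<noteq> t"
  shows "walk_trace \<omega> $ t = 1"
    and "x \<noteq> t \<Longrightarrow> 0 \<le> excess s (walk_trace \<omega>) x"
    and "x \<noteq> t \<Longrightarrow> excess s (walk_trace \<omega>) x \<le>
      (\<Sum>z\<in>-{t}-{x}. excess s (walk_trace \<omega>) z) + of_bool (x \<noteq> s)"
proof -
  define xs where "xs = butlast \<omega>"
  have \<omega>: "\<omega> = xs @ [t]" and t: "t \<notin> set xs"
    using w by (auto simp: proper_walk_def xs_def)
  have xs: "xs \<noteq> []" "hd xs = s"
    using w st \<omega> by (cases xs; auto simp: proper_walk_def)+
  have "successively complete_adj xs"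
    using w \<omega> by (auto simp: proper_walk_def successively_append_iff)
  then have suc: "successively (\<noteq>) xs" by (simp add: complete_adj_def[abs_def])
  have tr: "walk_trace \<omega> $ z = real (count_list xs z)" if "z \<noteq> t" for z
    using that by (simp add: walk_trace_nth \<omega>)
  show "walk_trace \<omega> $ t = 1" using t by (simp add: walk_trace_nth \<omega> count_notin)
  assume x: "x \<noteq> t"
  have "x = s \<Longrightarrow> count_list xs x \<noteq> 0" using xs by (cases xs) auto
  then show "0 \<le> excess s (walk_trace \<omega>) x"
    using x by (auto simp: excess_def tr)
  have "(\<Sum>z\<in>-{t}. count_list xs z) = length xs"
    by (rule sum_count_set) (use t in auto)
  then have "(\<Sum>z\<in>-{t}-{x}. count_list xs z) + count_list xs x = length xs"
    using x by (subst (asm) sum.remove[of _ x]) auto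
  then have "(\<Sum>z\<in>-{t}-{x}. real (count_list xs z)) + count_list xs x = length xs"
    by (metis of_nat_add of_nat_sum)
  moreover have "2 * real (count_list xs x) \<le> length xs + of_bool (x = s)"
    using count_list_successively_neq[OF suc xs(1), of x] xs(2) by (auto simp: of_bool_def split: if_splits)
  moreover have "(\<Sum>z\<in>-{t}-{x}. excess s (walk_trace \<omega>) z) =
      (\<Sum>z\<in>-{t}-{x}. real (count_list xs z)) - of_bool (x \<noteq> s)"
  proof -
    have "(\<Sum>z\<in>-{t}-{x}. excess s (walk_trace \<omega>) z) =
        (\<Sum>z\<in>-{t}-{x}. real (count_list xs z)) - (\<Sum>z\<in>-{t}-{x}. of_bool (z = s))"
      unfolding sum_subtractf[symmetric] by (rule sum.cong) (auto simp: excess_def tr)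
    also have "(\<Sum>z\<in>-{t}-{x}. of_bool (z = s)) = (of_bool (x \<noteq> s) :: real)"
      using st by (simp add: of_bool_def sum.delta' cong: if_cong)
    finally show ?thesis .
  qed
  ultimately show "excess s (walk_trace \<omega>) x \<le>
      (\<Sum>z\<in>-{t}-{x}. excess s (walk_trace \<omega>) z) + of_bool (x \<noteq> s)"
    using x by (auto simp: excess_def tr)
qed

section \<open>Test walks generating the hull\<close>

lemma proper_walk_direct: "s \<noteq> t \<Longrightarrow> proper_walk complete_adj s t [s, t]"
  by (simp add: proper_walk_def complete_adj_def)

lemma proper_walk_via:
  "s \<noteq> t \<Longrightarrow> y \<noteq> s \<Longrightarrow> y \<noteq> t \<Longrightarrow> proper_walk complete_adj s t [s, y, t]"
  by (auto simp: proper_walk_def complete_adj_def)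

text \<open>The head \<open>a\<close> is arbitrary so that the induction can continue with
  \<open>j\<close> in its place.\<close>

lemma successively_alternating:
  assumes "a \<noteq> i" "a \<noteq> t" "i \<noteq> j" "j \<noteq> t"
  shows "successively complete_adj (a # concat (replicate k [i, j]) @ [t])"
  using assms by (induction k arbitrary: a) (auto simp: complete_adj_def)

text \<open>Growing \<open>k\<close> supplies the recession directions of the hull. Since
  \<open>j = s\<close> is allowed, every pair of distinct non-target vertices is covered up to
  swapping.\<close>

lemma proper_walk_alternating:
  assumes "s \<noteq> t" "i \<noteq> s" "i \<noteq> j" "i \<noteq> t" "j \<noteq> t"
  shows "proper_walk complete_adj s t (s # concat (replicate k [i, j]) @ [t])"
  using assms successively_alternating[of s i t j k]
  by (auto simp: proper_walk_def butlast_append)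

lemma count_list_concat_replicate:
  "count_list (concat (replicate k xs)) x = k * count_list xs x"
  by (induction k) auto

lemma excess_walk_trace_alternating:
  assumes "x \<noteq> t"
  shows "excess s (walk_trace (s # concat (replicate k [i, j]) @ [t])) x =
    real k * (of_bool (x = i) + of_bool (x = j))"
  using assms by (auto simp: excess_def walk_trace_nth count_list_concat_replicate)

text \<open>Farkas-type dual: at most one coefficient of such a functional is negative, and it is
  outweighed by the others.\<close>

lemma pairwise_nonneg_functional_eq_0:
  fixes a m :: "'v \<Rightarrow> real"
  assumes fin: "finite V" and s: "s \<in> V"
    and m: "\<And>x. x \<in> V \<Longrightarrow> 0 < m x"
    and m': "\<And>x. x \<in> V \<Longrightarrow> m x < (\<Sum>z\<in>V-{x}. m z) + of_bool (x \<noteq> s)"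
    and pair: "\<And>i j. i \<in> V \<Longrightarrow> j \<in> V \<Longrightarrow> i \<noteq> j \<Longrightarrow> 0 \<le> a i + a j"
    and le0: "(\<Sum>x\<in>V. a x * m x) \<le> 0"
    and le1: "\<And>y. y \<in> V \<Longrightarrow> y \<noteq> s \<Longrightarrow> (\<Sum>x\<in>V. a x * m x) \<le> a y"
    and x: "x \<in> V"
  shows "a x = 0"
proof -
  have nonneg: "0 \<le> a i" if i: "i \<in> V" for i
  proof (rule ccontr)
    assume "\<not> 0 \<le> a i"
    then have neg: "a i < 0" by simp
    have "- a i * (\<Sum>z\<in>V-{i}. m z) \<le> (\<Sum>z\<in>V-{i}. a z * m z)"
      unfolding sum_distrib_left
    proof (rule sum_mono)
      fix z assume "z \<in> V - {i}"
      then have "- a i \<le> a z" "0 \<le> m z" using pair[of i z] m[of z] i by auto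
      then show "- a i * m z \<le> a z * m z" by (rule mult_right_mono)
    qed
    moreover have "(\<Sum>x\<in>V. a x * m x) = a i * m i + (\<Sum>z\<in>V-{i}. a z * m z)"
      by (rule sum.remove[OF fin i])
    ultimately have "- a i * ((\<Sum>z\<in>V-{i}. m z) - m i) \<le> (\<Sum>x\<in>V. a x * m x)"
      by (simp add: algebra_simps)
    moreover have "- a i * - of_bool (i \<noteq> s) < - a i * ((\<Sum>z\<in>V-{i}. m z) - m i)"
      using m'[OF i] neg by (intro mult_strict_left_mono) auto
    \<comment> \<open>The sum over \<open>V\<close> is now strictly above 0 if \<open>i = s\<close>,
      against \<open>le0\<close>, and strictly above \<open>a i\<close> otherwise, against
      \<open>le1\<close>.\<close>
    ultimately show False
      using le0 le1[OF i] by (cases "i = s") auto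
  qed
  have "(\<Sum>x\<in>V. a x * m x) = 0"
    using le0 nonneg m by (intro antisym sum_nonneg) (auto simp: less_imp_le)
  then have "a x * m x = 0"
    using fin x nonneg m by (subst (asm) sum_nonneg_eq_0_iff) (auto simp: less_imp_le)
  then show ?thesis using m[OF x] by simp
qed

lemma nonneg_of_multiples_bounded_below:
  fixes c d :: real
  assumes "\<And>k::nat. c \<le> real k * d"
  shows "0 \<le> d"
proof (rule ccontr)
  assume "\<not> 0 \<le> d"
  then obtain k :: nat where "- c < real k * - d"
    using reals_Archimedean3[of "- d", THEN spec, of "- c"] by auto
  then show False using assms[of k] by simp
qed

lemma trace_region_subset_hull:
  fixes s t :: "'v::finite"
  assumes st: "s \<noteq> t"
  shows "trace_region s t \<subseteq> convex hull {walk_trace \<omega> | \<omega>. proper_walk complete_adj s t \<omega>}"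
    (is "_ \<subseteq> ?C")
proof
  fix r :: "real ^ 'v" assume r: "r \<in> trace_region s t"
  define e where "e = (axis t 1 :: real ^ 'v)"
  \<comment> \<open>All traces have the same \<open>t\<close>-entry; thickening the hull in that direction excludes a separating
    functional that is constant on it.\<close>
  define C' where "C' = (\<Union>c\<in>?C. \<Union>d\<in>span {e}. {c + d})"
  have C'I: "walk_trace \<omega> + u *\<^sub>R e \<in> C'" if "proper_walk complete_adj s t \<omega>" for \<omega> u
  proof -
    have "walk_trace \<omega> \<in> ?C" using that by (auto intro!: hull_inc)
    moreover have "u *\<^sub>R e \<in> span {e}" by (simp add: span_base span_scale)
    ultimately show ?thesis unfolding C'_def by blast
  qed
  have C'E: "\<exists>c\<in>?C. \<exists>u. x = c + u *\<^sub>R e" if "x \<in> C'" for x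
    using that unfolding C'_def by (auto simp: span_singleton)
  have C1: "c $ t = 1" if "c \<in> ?C" for c
  proof -
    have "convex {c. c $ t = (1::real)}"
      by (auto simp: convex_def algebra_simps)
    then have "?C \<subseteq> {c. c $ t = 1}"
      by (intro hull_minimal) (auto simp: excess_walk_trace[OF _ st])
    then show ?thesis using that by auto
  qed
  have "r \<in> C'"
  proof (rule ccontr)
    assume "r \<notin> C'"
    moreover have "convex C'" unfolding C'_def
      by (intro convex_sums convex_convex_hull subspace_imp_convex subspace_span)
    moreover have "C' \<noteq> {}" using C'I[OF proper_walk_direct[OF st]] by auto
    ultimately obtain a b where a: "a \<noteq> 0" "a \<bullet> r \<le> b" "\<And>x. x \<in> C' \<Longrightarrow> b \<le> a \<bullet> x"
      using separating_hyperplane_sets[of "{r}" C'] by auto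
    have ar: "a \<bullet> r \<le> a \<bullet> walk_trace \<omega> + u * a $ t" if "proper_walk complete_adj s t \<omega>" for \<omega> u
      using a(2) a(3)[OF C'I[OF that, of u]]
      by (simp add: inner_add_right e_def inner_axis)
    \<comment> \<open>The bound \<open>ar\<close> holds arbitrarily far along \<open>e\<close> in
      both directions, which leaves only the value 0.\<close>
    have "0 \<le> a $ t"
      by (rule nonneg_of_multiples_bounded_below[of "a \<bullet> r - a \<bullet> walk_trace [s, t]"])
        (use ar[OF proper_walk_direct[OF st]] in \<open>simp add: algebra_simps\<close>)
    moreover have "0 \<le> - a $ t"
      by (rule nonneg_of_multiples_bounded_below[of "a \<bullet> r - a \<bullet> walk_trace [s, t]"])
        (use ar[OF proper_walk_direct[OF st], of "- real _"] in \<open>simp add: algebra_simps\<close>)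
    ultimately have at: "a $ t = 0" by simp
    define F where "F = (\<lambda>m :: 'v \<Rightarrow> real. \<Sum>x\<in>-{t}. a $ x * m x)"
    have inner_F: "a \<bullet> x = a $ s + F (excess s x)" for x
    proof -
      have "a \<bullet> x = (\<Sum>z\<in>UNIV. a $ z * x $ z)" by (simp add: inner_vec_def)
      also have "\<dots> = (\<Sum>z\<in>-{t}. a $ z * x $ z)"
        using at by (subst sum.remove[of _ t]) (auto simp: Compl_eq_Diff_UNIV)
      also have "\<dots> = (\<Sum>z\<in>-{t}. a $ z * of_bool (z = s) + a $ z * excess s x z)"
        by (rule sum.cong) (auto simp: excess_def algebra_simps)
      also have "(\<Sum>z\<in>-{t}. a $ z * of_bool (z = s) + a $ z * excess s x z) = a $ s + F (excess s x)"
        using st by (simp add: sum.distrib F_def of_bool_def if_distrib[where f = "\<lambda>u. _ * u"] sum.delta' cong: if_cong)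
      finally show ?thesis .
    qed
    have Fle: "F (excess s r) \<le> F (excess s (walk_trace \<omega>))" if "proper_walk complete_adj s t \<omega>" for \<omega>
      using ar[OF that, of 0] by (simp add: inner_F)
    have F_one: "F (\<lambda>x. c * of_bool (x = i)) = c * a $ i" if "i \<noteq> t" for c i
      using that unfolding F_def by (simp add: of_bool_def if_distrib[where f = "\<lambda>u. _ * u"] sum.delta' cong: if_cong)
    have pair: "0 \<le> a $ i + a $ j" if "i \<noteq> t" "j \<noteq> t" "i \<noteq> j" "i \<noteq> s" for i j
    proof (rule nonneg_of_multiples_bounded_below)
      fix k :: nat
      have "F (excess s (walk_trace (s # concat (replicate k [i, j]) @ [t]))) =
          F (\<lambda>x. real k * of_bool (x = i)) + F (\<lambda>x. real k * of_bool (x = j))"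
        unfolding F_def sum.distrib[symmetric]
        by (rule sum.cong) (auto simp: excess_walk_trace_alternating algebra_simps simp del: replicate.simps)
      then show "F (excess s r) \<le> real k * (a $ i + a $ j)"
        using Fle[OF proper_walk_alternating[OF st that(4,3,1,2), of k]] that(1,2)
        by (simp add: F_one algebra_simps)
    qed
    have "a $ x = 0" if "x \<in> -{t}" for x
    proof (rule pairwise_nonneg_functional_eq_0[where V = "-{t}" and m = "excess s r" and s = s and a = "\<lambda>x. a $ x"])
      show "0 \<le> a $ i + a $ j" if "i \<in> -{t}" "j \<in> -{t}" "i \<noteq> j" for i j
        using pair[of i j] pair[of j i] that by (cases "i = s") auto
      have "F (excess s (walk_trace [s, t])) = 0"
        unfolding F_def by (rule sum.neutral) (auto simp: excess_def walk_trace_nth)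
      then show "(\<Sum>x\<in>-{t}. a $ x * excess s r x) \<le> 0"
        using Fle[OF proper_walk_direct[OF st]] by (simp add: F_def)
      show "(\<Sum>x\<in>-{t}. a $ x * excess s r x) \<le> a $ y" if y: "y \<in> -{t}" "y \<noteq> s" for y
      proof -
        have "F (excess s (walk_trace [s, y, t])) = F (\<lambda>x. 1 * of_bool (x = y))"
          unfolding F_def by (rule sum.cong) (use y in \<open>auto simp: excess_def walk_trace_nth\<close>)
        then show ?thesis
          using Fle[OF proper_walk_via[OF st, of y]] F_one[of y 1] y by (simp add: F_def)
      qed
    qed (use r st that in \<open>auto simp: trace_region_def\<close>)
    then have "a $ x = 0" for x using at by (cases "x = t") auto
    then have "a = 0" by (simp add: vec_eq_iff)
    with a(1) show False by simp
  qed
  \<comment> \<open>Comparing the \<open>t\<close>-entries undoes the thickening along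
    \<open>e\<close>.\<close>
  then obtain c u where c: "c \<in> ?C" "r = c + u *\<^sub>R e" using C'E by blast
  have "r $ t = 1" using r by (simp add: trace_region_def)
  then have "u = 0" using c C1[OF c(1)] by (simp add: e_def)
  then show "r \<in> ?C" using c by simp
qed

section \<open>Relative interior of the hull\<close>

text \<open>The segment from \<open>c\<close> through \<open>r\<close> can be prolonged beyond
  \<open>r\<close> inside \<open>S\<close>; if the affine \<open>f\<close> were not positive at
  \<open>r\<close>, it would be negative at the new end.\<close>

lemma mem_rel_interior_less:
  fixes f :: "'n::euclidean_space \<Rightarrow> real"
  assumes "convex S" and r: "r \<in> rel_interior S"
    and f: "\<And>x y e. f ((1 - e) *\<^sub>R x + e *\<^sub>R y) = (1 - e) * f x + e * f y"
    and nonneg: "\<And>x. x \<in> S \<Longrightarrow> 0 \<le> f x" and c: "c \<in> S" "0 < f c"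
  shows "0 < f r"
proof -
  have "S \<noteq> {}" using c by auto
  then obtain e where e: "e > 1" "(1 - e) *\<^sub>R c + e *\<^sub>R r \<in> S"
    using r c(1) convex_rel_interior_iff[OF assms(1)] by blast
  then have "0 \<le> (1 - e) * f c + e * f r" using nonneg[OF e(2)] f by simp
  moreover have "(1 - e) * f c < 0" using e c by (simp add: mult_neg_pos)
  ultimately have "0 < e * f r" by simp
  then show ?thesis using e(1) by (simp add: zero_less_mult_iff)
qed

definition slack :: "'v \<Rightarrow> 'v \<Rightarrow> real ^ 'v \<Rightarrow> 'v::finite \<Rightarrow> real" where
  "slack s t r x = (\<Sum>z\<in>-{t}-{x}. excess s r z) + of_bool (x \<noteq> s) - excess s r x"

lemma trace_region_iff:
  "r \<in> trace_region s t \<longleftrightarrow> r $ t = 1 \<and> (\<forall>x\<in>-{t}. 0 < excess s r x \<and> 0 < slack s t r x)"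
  by (auto simp: trace_region_def slack_def)

lemma excess_affine:
  "excess s ((1 - e) *\<^sub>R r + e *\<^sub>R r') x = (1 - e) * excess s r x + e * excess s r' x"
  by (simp add: excess_def algebra_simps)

lemma slack_affine:
  "slack s t ((1 - e) *\<^sub>R r + e *\<^sub>R r') x = (1 - e) * slack s t r x + e * slack s t r' x"
  unfolding slack_def excess_affine sum.distrib sum_distrib_left[symmetric]
  by (simp add: algebra_simps)

lemma convex_halfspace_affine:
  fixes f :: "'a::real_vector \<Rightarrow> real"
  assumes f: "\<And>x y e. f ((1 - e) *\<^sub>R x + e *\<^sub>R y) = (1 - e) * f x + e * f y"
  shows "convex {x. 0 \<le> f x}"
  by (auto simp: convex_alt f)

text \<open>Each weak inequality holds on the hull and is strict at some trace, hence strict on the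
  relative interior. Conversely the strict inequalities survive a small prolongation of any segment
  from the hull to \<open>r\<close>, and the prolonged point is in the hull by
  \<open>trace_region_subset_hull\<close>.\<close>

lemma Psi_complete_eq:
  fixes s t :: "'v::finite"
  assumes st: "s \<noteq> t" and u: "u \<noteq> s" "u \<noteq> t"
  shows "Psi complete_adj s t = trace_region s t"
proof -
  define T where "T = {walk_trace \<omega> | \<omega>. proper_walk complete_adj s t \<omega>}"
  define C where "C = convex hull T"
  have cv: "convex C" unfolding C_def by simp
  have TC: "walk_trace \<omega> \<in> C" if "proper_walk complete_adj s t \<omega>" for \<omega>
    using that unfolding C_def T_def by (auto intro!: hull_inc)
  have ne: "C \<noteq> {}" using TC[OF proper_walk_direct[OF st]] by auto
  have C_le: "0 \<le> f c"
    if "\<And>\<omega>. proper_walk complete_adj s t \<omega> \<Longrightarrow> 0 \<le> f (walk_trace \<omega>)" "c \<in> C"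
      "\<And>x y e. f ((1 - e) *\<^sub>R x + e *\<^sub>R y) = (1 - e) * f x + e * f y" for f c
  proof -
    have "C \<subseteq> {x. 0 \<le> f x}"
      unfolding C_def T_def
      by (intro hull_minimal convex_halfspace_affine) (use that in auto)
    then show ?thesis using that(2) by auto
  qed
  have ex: "0 \<le> excess s c x" if "c \<in> C" "x \<noteq> t" for c x
    by (rule C_le[OF _ that(1)]) (use excess_walk_trace(2)[OF _ st that(2)] excess_affine in auto)
  have sl: "0 \<le> slack s t c x" if "c \<in> C" "x \<noteq> t" for c x
    by (rule C_le[OF _ that(1)])
      (use excess_walk_trace(3)[OF _ st that(2)] in \<open>simp add: slack_def\<close>, rule slack_affine)
  have one: "c $ t = 1" if "c \<in> C" for c
  proof -
    have "0 \<le> c $ t - 1"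
      by (rule C_le[OF _ that]) (auto simp: excess_walk_trace(1)[OF _ st] algebra_simps)
    moreover have "0 \<le> 1 - c $ t"
      by (rule C_le[OF _ that]) (auto simp: excess_walk_trace(1)[OF _ st] algebra_simps)
    ultimately show ?thesis by simp
  qed
  have "rel_interior C \<subseteq> trace_region s t"
  proof
    fix r assume r: "r \<in> rel_interior C"
    have rC: "r \<in> C" using r rel_interior_subset by auto
    have alt: "walk_trace (s # concat (replicate k [i, j]) @ [t]) \<in> C"
      if "i \<noteq> t" "j \<noteq> t" "i \<noteq> j" "i \<noteq> s" for i j k
      by (rule TC[OF proper_walk_alternating[OF st that(4,3,1,2)]])
    have "0 < excess s r x" if x: "x \<noteq> t" for x
    proof (rule mem_rel_interior_less[OF cv r excess_affine ex[OF _ x]])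
      \<comment> \<open>The block \<open>[i, s]\<close> must visit \<open>x\<close> after time 0:
        for \<open>x = s\<close> it returns from \<open>u\<close>, otherwise it goes to
        \<open>x\<close> itself.\<close>
      define i where "i = (if x = s then u else x)"
      show "walk_trace (s # concat (replicate 1 [i, s]) @ [t]) \<in> C"
        by (rule alt) (use u x st in \<open>auto simp: i_def\<close>)
      show "0 < excess s (walk_trace (s # concat (replicate 1 [i, s]) @ [t])) x"
        unfolding excess_walk_trace_alternating[OF x] by (auto simp: i_def)
    qed
    moreover have "0 < slack s t r x" if x: "x \<noteq> t" for x
    proof (cases "x = s")
      case True
      have "walk_trace [s, u, t] \<in> C"
        by (rule TC[OF proper_walk_via[OF st u]])
      moreover have "(\<Sum>z\<in>-{t}-{s}. excess s (walk_trace [s, u, t]) z) = (\<Sum>z\<in>-{t}-{s}. of_bool (z = u))"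
        by (rule sum.cong) (auto simp: excess_def walk_trace_nth)
      then have "0 < slack s t (walk_trace [s, u, t]) x"
        using True u st by (simp add: slack_def excess_def walk_trace_nth of_bool_def sum.delta' cong: if_cong)
      ultimately show ?thesis
        using mem_rel_interior_less[where f = "\<lambda>r. slack s t r x", OF cv r slack_affine sl[OF _ x]]
        by blast
    next
      case False
      have "walk_trace [s, t] \<in> C"
        by (rule TC[OF proper_walk_direct[OF st]])
      moreover have "(\<Sum>z\<in>-{t}-{x}. excess s (walk_trace [s, t]) z) = 0"
        by (rule sum.neutral) (auto simp: excess_def walk_trace_nth)
      then have "0 < slack s t (walk_trace [s, t]) x"
        using False x by (simp add: slack_def excess_def walk_trace_nth)
      ultimately show ?thesis
        using mem_rel_interior_less[where f = "\<lambda>r. slack s t r x", OF cv r slack_affine sl[OF _ x]]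
        by blast
    qed
    ultimately show "r \<in> trace_region s t"
      using one[OF rC] by (auto simp: trace_region_iff)
  qed
  moreover have "trace_region s t \<subseteq> rel_interior C"
  proof
    fix r assume r: "r \<in> trace_region s t"
    show "r \<in> rel_interior C"
    proof (subst convex_rel_interior_iff[OF cv ne], rule ballI)
      fix c assume c: "c \<in> C"
      let ?g = "\<lambda>e. (1 - e) *\<^sub>R c + e *\<^sub>R r"
      \<comment> \<open>At \<open>e = 1\<close> the combination equals \<open>q > 0\<close>, and
        there are finitely many constraints, so a common \<open>e > 1\<close> works.\<close>
      have ev: "\<forall>\<^sub>F e in at_right 1. 0 < (1 - e) * p + e * q" if "0 < q" for p q :: real
      proof (rule order_tendstoD(1)[of _ q])
        have "((\<lambda>e. (1 - e) * p + e * q) \<longlongrightarrow> (1 - 1) * p + 1 * q) (at_right (1::real))"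
          by (intro tendsto_intros)
        then show "((\<lambda>e. (1 - e) * p + e * q) \<longlongrightarrow> q) (at_right (1::real))" by simp
      qed fact
      have "\<forall>\<^sub>F e in at_right 1. \<forall>x\<in>-{t}. 0 < excess s (?g e) x \<and> 0 < slack s t (?g e) x"
        unfolding excess_affine slack_affine
        by (intro eventually_ball_finite ballI eventually_conj ev)
          (use r in \<open>auto simp: trace_region_iff\<close>)
      then have "\<forall>\<^sub>F e in at_right 1. 1 < e \<and> (\<forall>x\<in>-{t}. 0 < excess s (?g e) x \<and> 0 < slack s t (?g e) x)"
        by (intro eventually_conj eventually_at_right_less)
      then obtain e :: real where e: "1 < e" "\<forall>x\<in>-{t}. 0 < excess s (?g e) x \<and> 0 < slack s t (?g e) x"
        using eventually_happens'[OF trivial_limit_at_right_real] by blast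
      have "?g e $ t = 1" using one[OF c] r by (simp add: trace_region_iff)
      then have "?g e \<in> trace_region s t" using e(2) trace_region_iff by blast
      then show "\<exists>e>1. ?g e \<in> C"
        using e(1) trace_region_subset_hull[OF st] unfolding C_def T_def by blast
    qed
  qed
  ultimately show ?thesis unfolding Psi_def C_def T_def by blast
qed

text \<open>Here \<open>trace_region\<close> is empty, so this case is separate. The upper bound on
  the excess at \<open>s\<close> has an empty sum and forces a single trace, and a singleton is its
  own relative interior.\<close>

lemma Psi_complete_two:
  fixes s t :: "'v::finite"
  assumes st: "s \<noteq> t" and two: "\<And>u. u = s \<or> u = t"
  shows "Psi complete_adj s t = {\<chi> x. 1}"
proof -
  have "{walk_trace \<omega> | \<omega>. proper_walk complete_adj s t \<omega>} = {\<chi> x. 1}"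
  proof -
    have "walk_trace \<omega> = (\<chi> x. 1)" if w: "proper_walk complete_adj s t \<omega>" for \<omega>
    proof -
      have "-{t} - {s} = {}" using two by auto
      then have "excess s (walk_trace \<omega>) s = 0"
        using excess_walk_trace(2,3)[OF w st st] by (simp only: sum.empty) simp
      then have "walk_trace \<omega> $ s = 1" by (simp add: excess_def)
      then show ?thesis
        unfolding vec_eq_iff vec_lambda_beta using excess_walk_trace(1)[OF w st] two by metis
    qed
    moreover have "proper_walk complete_adj s t [s, t]" using st by (rule proper_walk_direct)
    ultimately show ?thesis
      unfolding set_eq_iff mem_Collect_eq singleton_iff by metis
  qed
  then show ?thesis by (simp add: Psi_def)
qed

section \<open>The quadratic system\<close>

text \<open>The bounds keep \<open>1 - c * q'\<close> nonnegative, where squaring is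
  monotone.\<close>

lemma antimono_discriminant:
  fixes c m q q' :: real
  assumes "0 \<le> c" "c \<le> 1" "0 \<le> m" "q \<le> q'" "q' \<le> 1"
  shows "(1 - c * q')\<^sup>2 - 4 * q' * m \<le> (1 - c * q)\<^sup>2 - 4 * q * m"
proof -
  have "c * q' \<le> 1"
    using assms by (metis mult_le_one mult_nonneg_nonpos order_trans linear zero_le_one)
  then have "(1 - c * q')\<^sup>2 \<le> (1 - c * q)\<^sup>2"
    using assms by (intro power_mono) (auto intro: mult_left_mono)
  moreover have "4 * q * m \<le> 4 * q' * m" using assms by (intro mult_right_mono) auto
  ultimately show ?thesis by simp
qed

text \<open>The equation for each \<open>p z\<close> is quadratic with small root \<open>q * g z q\<close>. Taking the small root
  everywhere makes the sum too small as \<open>q \<rightarrow> 0\<close>; replacing it by the large root at the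
  index \<open>i\<close> whose discriminant vanishes first makes the sum too large. The two branches agree where
  that discriminant vanishes, so the intermediate value theorem applies to one of them.\<close>

lemma quadratic_system_solvable:
  fixes m :: "'v \<Rightarrow> real"
  assumes fin: "finite V" and s: "s \<in> V"
    and m: "\<And>x. x \<in> V \<Longrightarrow> 0 < m x"
    and m': "\<And>x. x \<in> V \<Longrightarrow> m x < (\<Sum>z\<in>V-{x}. m z) + of_bool (x \<noteq> s)"
  obtains p q where "0 < q" "(\<Sum>z\<in>V. p z) = 1 - q" "\<And>z. z \<in> V \<Longrightarrow> 0 < p z"
    "\<And>z. z \<in> V \<Longrightarrow> p z * (1 - of_bool (z = s) * q - p z) = q * m z"
proof -
  define c where "c z q = 1 - of_bool (z = s) * q" for z and q :: real
  define D where "D z q = (c z q)\<^sup>2 - 4 * q * m z" for z q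
  \<comment> \<open>\<open>D\<close> is the discriminant of
    \<open>p\<^sup>2 - c p + q m = 0\<close>. Rationalising the small root and dividing by
    \<open>q\<close> keeps \<open>g\<close> continuous at 0, with value \<open>m z\<close>
    there.\<close>
  define g where "g z q = 2 * m z / (c z q + sqrt (D z q))" for z q
  have D_anti: "D z q' \<le> D z q" if "z \<in> V" "q \<le> q'" "q' \<le> 1" for z q q'
    unfolding D_def c_def using that m[of z]
    by (intro antimono_discriminant) auto
  have root: "\<exists>q. 0 < q \<and> D z q = 0" if z: "z \<in> V" "z \<noteq> s" for z
    using m[OF z(1)] z(2) by (intro exI[of _ "1 / (4 * m z)"]) (simp add: D_def c_def)
  have root_s: "\<exists>q. 0 < q \<and> q < 1 \<and> D s q = 0"
  proof -
    have "\<exists>q. 0 \<le> q \<and> q \<le> 1 \<and> D s q = 0"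
      using m[OF s] by (intro IVT2') (auto simp: D_def c_def intro!: continuous_intros)
    then obtain q where q: "0 \<le> q" "q \<le> 1" "D s q = 0" by blast
    moreover have "q \<noteq> 0" "q \<noteq> 1" using q(3) m[OF s] by (auto simp: D_def c_def)
    ultimately show ?thesis by (intro exI[of _ q]) auto
  qed
  define rt where "rt z = (SOME q. 0 < q \<and> D z q = 0 \<and> (z = s \<longrightarrow> q < 1))" for z
  have rt: "0 < rt z" "D z (rt z) = 0" "z = s \<Longrightarrow> rt z < 1" if "z \<in> V" for z
  proof -
    have "\<exists>q. 0 < q \<and> D z q = 0 \<and> (z = s \<longrightarrow> q < 1)"
      using root[OF that] root_s by (cases "z = s") auto
    from someI_ex[OF this] show "0 < rt z" "D z (rt z) = 0" "z = s \<Longrightarrow> rt z < 1"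
      unfolding rt_def by auto
  qed
  define Q where "Q = Min (rt ` V)"
  have "Q \<in> rt ` V" unfolding Q_def using fin s by (intro Min_in) auto
  then obtain i where i: "i \<in> V" "Q = rt i" by auto
  have Q_le: "Q \<le> rt z" if "z \<in> V" for z
    unfolding Q_def using fin that by (intro Min_le) auto
  have Q: "0 < Q" "Q < 1" "D i Q = 0"
    using i rt[OF i(1)] Q_le[OF s] rt(3)[OF s] by auto
  have DQ: "0 \<le> D z Q" if z: "z \<in> V" for z
  proof (cases "z = s")
    case True
    then show ?thesis using D_anti[OF z Q_le[OF z]] rt[OF z] by auto
  next
    case False
    \<comment> \<open>For \<open>z \<noteq> s\<close> the root may exceed 1, beyond the range of
      \<open>D_anti\<close>, but \<open>D\<close> is then linear in \<open>q\<close>.\<close>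
    have "4 * Q * m z \<le> 4 * rt z * m z"
      using Q_le[OF z] m[OF z] by (intro mult_right_mono) auto
    then show ?thesis using rt(2)[OF z] False by (simp add: D_def c_def)
  qed
  have D0: "0 \<le> D z q" if "z \<in> V" "q \<le> Q" for z q
    using D_anti[OF that(1,2)] DQ[OF that(1)] Q by simp
  have c0: "0 < c z q" if "q \<le> Q" for z q
    using that Q by (auto simp: c_def)
  have den: "0 < c z q + sqrt (D z q)" if "z \<in> V" "q \<le> Q" for z q
    using c0[OF that(2), of z] D0[OF that] by (simp add: add_pos_nonneg)
  have cont: "continuous_on {0..Q} (g z)" if "z \<in> V" for z
  proof -
    have "continuous_on {0..Q} (\<lambda>q. c z q + sqrt (D z q))"
      unfolding D_def c_def by (intro continuous_intros)
    moreover have "c z q + sqrt (D z q) \<noteq> 0" if "q \<in> {0..Q}" for q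
      using den[OF \<open>z \<in> V\<close>, of q] that by simp
    ultimately show ?thesis
      unfolding g_def by (intro continuous_on_divide continuous_on_const) auto
  qed
  have small: "q * g z q = (c z q - sqrt (D z q)) / 2" if "z \<in> V" "q \<le> Q" for z q
  proof -
    have "(c z q - sqrt (D z q)) * (c z q + sqrt (D z q)) = 4 * q * m z"
      using D0[OF that] by (simp add: algebra_simps power2_eq_square[symmetric]) (simp add: D_def power2_eq_square)
    then show ?thesis using den[OF that] by (simp add: g_def field_simps)
  qed
  have small_eq: "q * g z q * (c z q - q * g z q) = q * m z" if "z \<in> V" "q \<le> Q" for z q
    using D0[OF that] unfolding small[OF that]
    by (simp add: field_simps power2_eq_square[symmetric]) (simp add: D_def power2_eq_square algebra_simps)
  have g_pos: "0 < g z q" if "z \<in> V" "q \<le> Q" for z q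
    using den[OF that] m[OF that(1)] by (simp add: g_def)
  have small_lt: "q * g z q < c z q" if "z \<in> V" "q \<le> Q" for z q
    using c0[OF that(2), of z] D0[OF that] unfolding small[OF that]
    by (simp add: field_simps add_pos_nonneg)
  have g0: "g z 0 = m z" for z by (simp add: g_def c_def D_def)
  \<comment> \<open>\<open>H q = 0\<close> says that the small roots sum to \<open>1 - q\<close>.
    For \<open>q > 0\<close>, \<open>G q = 0\<close> says the same with the large root
    \<open>c i q - q * g i q\<close> at \<open>i\<close>, after division by
    \<open>q\<close>.\<close>
  define H where "H q = q * (\<Sum>z\<in>V. g z q) + q - 1" for q
  define G where "G q = (\<Sum>z\<in>V-{i}. g z q) - g i q + of_bool (i \<noteq> s)" for q
  have sum_i: "(\<Sum>z\<in>V. f z) = f i + (\<Sum>z\<in>V-{i}. f z)" for f :: "'v \<Rightarrow> real"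
    by (rule sum.remove[OF fin i(1)])
  have HG: "q * G q = H q + c i q - 2 * (q * g i q)" for q
    by (simp add: H_def G_def sum_i c_def algebra_simps)
  show thesis
  proof (cases "0 \<le> H Q")
    case True
    have "\<exists>q. 0 \<le> q \<and> q \<le> Q \<and> H q = 0"
      using True Q unfolding H_def
      by (intro IVT') (auto intro!: continuous_intros cont)
    then obtain q where q: "0 \<le> q" "q \<le> Q" "H q = 0" by blast
    have "q \<noteq> 0" using q(3) by (auto simp: H_def)
    then have q0: "0 < q" using q by simp
    show thesis
    proof (rule that[of q "\<lambda>z. q * g z q"])
      show "(\<Sum>z\<in>V. q * g z q) = 1 - q"
        using q(3) by (simp add: H_def sum_distrib_left)
      show "0 < q * g z q" if "z \<in> V" for z
        using g_pos[OF that q(2)] q0 by simp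
      show "q * g z q * (1 - of_bool (z = s) * q - q * g z q) = q * m z" if "z \<in> V" for z
        using small_eq[OF that q(2)] by (simp only: c_def)
    qed fact
  next
    case False
    have "Q * G Q = H Q"
      unfolding HG small[OF i(1) order_refl] using Q by simp
    then have "G Q \<le> 0" using False Q by (metis linorder_not_le mult_nonneg_nonneg less_imp_le)
    \<comment> \<open>\<open>G 0\<close> is the gap in the strict upper bound on \<open>m i\<close>;
      its positivity also excludes the root \<open>q = 0\<close> below.\<close>
    moreover have "0 \<le> G 0" using m'[OF i(1)] by (simp add: G_def g0)
    ultimately have "\<exists>q. 0 \<le> q \<and> q \<le> Q \<and> G q = 0"
      using Q i(1) unfolding G_def
      by (intro IVT2') (auto intro!: continuous_intros cont)
    then obtain q where q: "0 \<le> q" "q \<le> Q" "G q = 0" by blast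
    have "q \<noteq> 0" using q(3) m'[OF i(1)] by (auto simp: G_def g0)
    then have q0: "0 < q" using q by simp
    define p where "p z = (if z = i then c i q - q * g i q else q * g z q)" for z
    show thesis
    proof (rule that[of q p])
      have "(\<Sum>z\<in>V. p z) = c i q - q * g i q + q * (\<Sum>z\<in>V-{i}. g z q)"
        unfolding sum_i[of p] sum_distrib_left by (simp add: p_def)
      also have "(\<Sum>z\<in>V-{i}. g z q) = g i q - of_bool (i \<noteq> s)"
        using q(3) by (simp add: G_def)
      finally show "(\<Sum>z\<in>V. p z) = 1 - q"
        by (cases "i = s") (simp_all add: c_def algebra_simps)
      show "0 < p z" if "z \<in> V" for z
        using g_pos[OF that q(2)] small_lt[OF that q(2)] q0 by (auto simp: p_def)
      show "p z * (1 - of_bool (z = s) * q - p z) = q * m z" if "z \<in> V" for z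
        using small_eq[OF that q(2)] unfolding c_def[symmetric]
        by (cases "z = i") (simp_all add: p_def mult.commute)
    qed fact
  qed
qed

text \<open>Since \<open>p\<close> sums to \<open>1 - q\<close>, the bracket for \<open>x\<close> is
  the sum of the other \<open>p z\<close>, plus \<open>q\<close> if \<open>x \<noteq> s\<close>. For
  \<open>z \<noteq> x\<close>, \<open>p x + p z \<le> 1 - q\<close> gives
  \<open>q * m z \<ge> p z * (p x + [z \<noteq> s] q)\<close>, and summing over \<open>z\<close>
  bounds \<open>q * m x\<close>. Strictness comes from the positive weight of the other vertices if
  \<open>x = s\<close>, and from \<open>p x < 1\<close> otherwise.\<close>

lemma quadratic_system_imp_strict:
  fixes m p :: "'v \<Rightarrow> real"
  assumes fin: "finite V" and s: "s \<in> V" and u: "u \<in> V" "u \<noteq> s"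
    and q: "0 < q" and sum_p: "(\<Sum>z\<in>V. p z) = 1 - q" and p: "\<And>z. z \<in> V \<Longrightarrow> 0 < p z"
    and eq: "\<And>z. z \<in> V \<Longrightarrow> p z * (1 - of_bool (z = s) * q - p z) = q * m z"
    and x: "x \<in> V"
  shows "0 < m x" and "m x < (\<Sum>z\<in>V-{x}. m z) + of_bool (x \<noteq> s)"
proof -
  have c: "1 - of_bool (x = s) * q - p x = (\<Sum>z\<in>V-{x}. p z) + of_bool (x \<noteq> s) * q"
    using sum_p sum.remove[OF fin x, of p] by auto
  have "V - {x} \<noteq> {}" using u s by (cases "x = s") auto
  then have pos: "0 < (\<Sum>z\<in>V-{x}. p z)" using fin p by (intro sum_pos) auto
  have px: "0 < p x" using p x by simp
  have "0 < q * m x"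
    unfolding eq[OF x, symmetric] c using pos px q by (intro mult_pos_pos add_pos_nonneg) auto
  then show "0 < m x" using q by (simp add: zero_less_mult_iff)
  have lt1: "p x < 1" using sum_p sum.remove[OF fin x, of p] pos q by simp
  have "q * m x = p x * (\<Sum>z\<in>V-{x}. p z) + of_bool (x \<noteq> s) * q * p x"
    unfolding eq[OF x, symmetric] c by (simp add: algebra_simps)
  also have "\<dots> < p x * (\<Sum>z\<in>V-{x}. p z) + q * (\<Sum>z\<in>V-{x}. of_bool (z \<noteq> s) * p z) + of_bool (x \<noteq> s) * q"
  proof (cases "x = s")
    case True
    then have "(\<Sum>z\<in>V-{x}. of_bool (z \<noteq> s) * p z) = (\<Sum>z\<in>V-{x}. p z)"
      by (intro sum.cong) auto
    then show ?thesis using True pos q by simp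
  next
    case False
    moreover have "0 \<le> (\<Sum>z\<in>V-{x}. of_bool (z \<noteq> s) * p z)"
      using p by (intro sum_nonneg) (auto simp: less_imp_le)
    ultimately show ?thesis using q lt1 by (simp add: add_strict_increasing2)
  qed
  also have "p x * (\<Sum>z\<in>V-{x}. p z) + q * (\<Sum>z\<in>V-{x}. of_bool (z \<noteq> s) * p z) =
      (\<Sum>z\<in>V-{x}. p z * (p x + of_bool (z \<noteq> s) * q))"
    by (simp add: sum_distrib_left sum.distrib[symmetric] algebra_simps)
  also have "\<dots> \<le> (\<Sum>z\<in>V-{x}. q * m z)"
  proof (rule sum_mono)
    fix z assume z: "z \<in> V - {x}"
    have "p z + p x = (\<Sum>y\<in>{x, z}. p y)" using z by auto
    also have "\<dots> \<le> (\<Sum>y\<in>V. p y)"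
      using fin x z p by (intro sum_mono2) (auto simp: less_imp_le)
    finally have "p x + of_bool (z \<noteq> s) * q \<le> 1 - of_bool (z = s) * q - p z"
      using sum_p by auto
    then show "p z * (p x + of_bool (z \<noteq> s) * q) \<le> q * m z"
      using p[of z] z eq[of z] by (metis DiffD1 less_imp_le mult_left_mono)
  qed
  finally have "q * m x < q * ((\<Sum>z\<in>V-{x}. m z) + of_bool (x \<noteq> s))"
    by (simp add: sum_distrib_left algebra_simps)
  then show "m x < (\<Sum>z\<in>V-{x}. m z) + of_bool (x \<noteq> s)" using q by simp
qed

section \<open>Solvable vectors\<close>

lemma occupation_quadratic_system:
  fixes \<rho> :: "'v::finite \<Rightarrow> real"
  assumes \<rho>: "\<And>x. 0 < \<rho> x" and "z \<noteq> t"
  defines "S \<equiv> \<Sum>z\<in>UNIV. \<rho> z"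
  shows "\<rho> z / S * (1 - of_bool (z = s) * (\<rho> t / S) - \<rho> z / S) =
    \<rho> t / S * (occupation s t \<rho> z - of_bool (z = s))"
proof -
  have "0 < S" unfolding S_def using \<rho> by (intro sum_pos) auto
  then show ?thesis
    using \<rho>[of t] \<open>z \<noteq> t\<close> unfolding occupation_def S_def[symmetric] by (simp add: field_simps)
qed

lemma occupation_solvable_iff:
  fixes r :: "real ^ 'v::finite"
  assumes st: "s \<noteq> t" and u: "u \<noteq> s" "u \<noteq> t"
  shows "(\<exists>\<rho>. (\<forall>x. 0 < \<rho> x) \<and> (\<forall>x. r $ x = occupation s t \<rho> x)) \<longleftrightarrow> r \<in> trace_region s t"
proof
  assume "\<exists>\<rho>. (\<forall>x. 0 < \<rho> x) \<and> (\<forall>x. r $ x = occupation s t \<rho> x)"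
  then obtain \<rho> where \<rho>: "\<And>x. 0 < \<rho> x" and r: "\<And>x. r $ x = occupation s t \<rho> x" by blast
  define S where "S = (\<Sum>z\<in>UNIV. \<rho> z)"
  have S: "0 < S" unfolding S_def using \<rho> by (intro sum_pos) auto
  have split: "S = \<rho> t + (\<Sum>z\<in>-{t}. \<rho> z)"
    unfolding S_def by (subst sum.remove[of _ t]) (auto simp: Compl_eq_Diff_UNIV)
  have sum: "(\<Sum>z\<in>-{t}. \<rho> z / S) = 1 - \<rho> t / S"
    using S split by (simp add: sum_divide_distrib[symmetric] field_simps)
  have eq: "\<rho> z / S * (1 - of_bool (z = s) * (\<rho> t / S) - \<rho> z / S) = \<rho> t / S * excess s r z"
    if "z \<in> -{t}" for z
    using occupation_quadratic_system[of \<rho> z t s] that \<rho>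
    unfolding S_def[symmetric] excess_def r by simp
  have "0 < excess s r x \<and> excess s r x < (\<Sum>z\<in>-{t}-{x}. excess s r z) + of_bool (x \<noteq> s)"
    if "x \<in> -{t}" for x
    using quadratic_system_imp_strict[OF _ _ _ u(1) _ sum _ eq that] st u S \<rho> by simp
  then show "r \<in> trace_region s t"
    by (simp add: trace_region_def r occupation_def)
next
  assume r: "r \<in> trace_region s t"
  obtain p q where q: "0 < q" and sum: "(\<Sum>z\<in>-{t}. p z) = 1 - q"
    and p: "\<And>z. z \<in> -{t} \<Longrightarrow> 0 < p z"
    and eq: "\<And>z. z \<in> -{t} \<Longrightarrow> p z * (1 - of_bool (z = s) * q - p z) = q * excess s r z"
    by (rule quadratic_system_solvable[of "-{t}" s "excess s r"])
      (use r st in \<open>auto simp: trace_region_def\<close>)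
  \<comment> \<open>These weights have total 1, so they coincide with their normalisation and
    \<open>occupation_quadratic_system\<close> can be matched with \<open>eq\<close>
    directly.\<close>
  define \<rho> where "\<rho> = p(t := q)"
  have "(\<Sum>z\<in>UNIV. \<rho> z) = q + (\<Sum>z\<in>-{t}. \<rho> z)"
    by (subst sum.remove[of _ t]) (auto simp: \<rho>_def Compl_eq_Diff_UNIV)
  also have "(\<Sum>z\<in>-{t}. \<rho> z) = (\<Sum>z\<in>-{t}. p z)"
    by (rule sum.cong) (auto simp: \<rho>_def)
  finally have one: "(\<Sum>z\<in>UNIV. \<rho> z) = 1" using sum by simp
  have \<rho>: "0 < \<rho> x" for x using p q by (simp add: \<rho>_def)
  have "r $ x = occupation s t \<rho> x" for x
  proof (cases "x = t")
    case True
    then show ?thesis using r by (simp add: trace_region_def occupation_def)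
  next
    case False
    then have "q * excess s r x = q * (occupation s t \<rho> x - of_bool (x = s))"
      using eq[of x] occupation_quadratic_system[of \<rho> x t s, OF \<rho> False]
      unfolding one by (simp add: \<rho>_def)
    then show ?thesis using q by (simp add: excess_def)
  qed
  then show "\<exists>\<rho>. (\<forall>x. 0 < \<rho> x) \<and> (\<forall>x. r $ x = occupation s t \<rho> x)" using \<rho> by blast
qed

lemma occupation_two:
  fixes \<rho> :: "'v::finite \<Rightarrow> real"
  assumes \<rho>: "\<And>x. 0 < \<rho> x" and st: "s \<noteq> t" and two: "\<And>u. u = s \<or> u = t"
  shows "occupation s t \<rho> x = 1"
proof -
  have univ: "UNIV = {s, t}" using two by auto
  have S: "(\<Sum>z\<in>UNIV. \<rho> z) = \<rho> s + \<rho> t" unfolding univ using st by simp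
  have "\<rho> s + \<rho> t \<noteq> 0" "\<rho> t \<noteq> 0" using \<rho>[of s] \<rho>[of t] by auto
  then have "(1 + \<rho> s / \<rho> t) * (1 - \<rho> s / (\<rho> s + \<rho> t)) = 1"
    by (simp add: divide_simps)
  then show ?thesis
    using two[of x] st by (auto simp: occupation_def S)
qed

theorem theorem10:
  fixes n :: nat and v :: "nat \<Rightarrow> 'v::finite" and r :: "real ^ 'v"
  assumes "2 \<le> n" and "bij_betw v {1..n} UNIV"
  shows "tau_solvable complete_adj (v 2) (v 1) r \<longleftrightarrow> r \<in> Psi complete_adj (v 2) (v 1)"
proof -
  have st: "v 2 \<noteq> v 1"
    using assms inj_onD[of v "{1..n}" 2 1] by (auto simp: bij_betw_def)
  show ?thesis
  proof (cases "\<exists>u. u \<noteq> v 2 \<and> u \<noteq> v 1")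
    case True
    then obtain u where u: "u \<noteq> v 2" "u \<noteq> v 1" by blast
    show ?thesis
      using tau_solvable_complete_iff[OF st] occupation_solvable_iff[OF st u] Psi_complete_eq[OF st u]
      by simp
  next
    case False
    then have two: "u = v 2 \<or> u = v 1" for u by blast
    \<comment> \<open>With two vertices every positive weight gives the all-ones vector, so
      solvability also relies on some positive weight existing.\<close>
    have "tau_solvable complete_adj (v 2) (v 1) r \<longleftrightarrow> (\<forall>x. r $ x = 1)"
    proof -
      have "occupation (v 2) (v 1) \<rho> x = 1" if "\<forall>x. 0 < \<rho> x" for \<rho> x
        using occupation_two[of \<rho>, OF _ st two] that by blast
      moreover have "\<exists>\<rho> :: 'v \<Rightarrow> real. \<forall>x. 0 < \<rho> x" by (rule exI[of _ "\<lambda>_. 1"]) simp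
      ultimately show ?thesis unfolding tau_solvable_complete_iff[OF st] by metis
    qed
    then show ?thesis
      unfolding Psi_complete_two[OF st two] by (simp add: vec_eq_iff)
  qed
qed

end
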